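(* Let $\mathrm{DEG}=\{(\mu,\nu)\mid \mu,\nu\in\omega\cup\{\infty\},\ \mu\leq\nu\}$. 1. For every structure $\mathcal{M}$, the pair $\left(\deg^{\exists\text{-}\mathrm{sem}}_{\mathrm{rig}}(\mathcal{M}),\ \deg^{\exists\text{-}\mathrm{synt}}_{\mathrm{rig}}(\mathcal{M})\right)$ belongs to $\mathrm{DEG}$. 2. For each pair $(\mu,\nu)\in\mathrm{DEG}$ there exists a structure $\mathcal{M}_{\mu,\nu}$ such that $\deg^{\exists\text{-}\mathrm{sem}}_{\mathrm{rig}}(\mathcal{M}_{\mu,\nu})=\mu$ and $\deg^{\exists\text{-}\mathrm{synt}}_{\mathrm{rig}}(\mathcal{M}_{\mu,\nu})=\nu$.
   Context: Structures are first-order structures; the universe of $\mathcal{M}$ is denoted $M$. For $A\subseteq M$, $\mathrm{dcl}(A)$ is the set of $b\in M$ such that $\{b\}$ is definable in $\mathcal{M}$ by a first-order formula with parameters from $A$. The structure $\mathcal{M}$ is semantically $A$-rigid if the only automorphism of $\mathcal{M}$ fixing $A$ pointwise is the identity; it is syntactically $A$-rigid if $M=\mathrm{dcl}(A)$. For $n\in\omega$, $\mathcal{M}$ is $\exists$-semantically (respectively $\exists$-syntactically) $n$-rigid if it is semantically (respectively syntactically) $A$-rigid for some $A\subseteq M$ with $|A|=n$. The degree $\deg^{\exists\text{-}\mathrm{sem}}_{\mathrm{rig}}(\mathcal{M})$ (respectively $\deg^{\exists\text{-}\mathrm{synt}}_{\mathrm{rig}}(\mathcal{M})$) is the least $n\in\omega$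 such that $\mathcal{M}$ is $\exists$-semantically (respectively $\exists$-syntactically) $n$-rigid, and is $\infty$ if no such $n$ exists. The order on $\omega\cup\{\infty\}$ has $n<\infty$ for all $n\in\omega$. *)

theory Defs
  imports Main "HOL-Library.Extended_Nat"
begin

section \<open>First-order structures\<close>

text \<open>
  A structure carries its signature: the sets of function and relation symbols (either may be
  empty) and their arities.  Constants are function symbols of arity 0.  The values of
  \<open>fun_interp\<close> and \<open>rel_interp\<close> matter only for symbols of the signature and for argument
  lists over the universe of the right length.
\<close>

record ('f, 'r, 'a) fo_structure =
  fun_syms :: "'f set"
  fun_arity :: "'f \<Rightarrow> nat"
  rel_syms :: "'r set"
  rel_arity :: "'r \<Rightarrow> nat"
  universe :: "'a set"
  fun_interp :: "'f \<Rightarrow> 'a list \<Rightarrow> 'a"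
  rel_interp :: "'r \<Rightarrow> 'a list set"

definition tuples :: "('f, 'r, 'a) fo_structure \<Rightarrow> nat \<Rightarrow> 'a list set" where
  "tuples M n = {xs. length xs = n \<and> set xs \<subseteq> universe M}"

definition is_structure :: "('f, 'r, 'a) fo_structure \<Rightarrow> bool" where
  "is_structure M \<longleftrightarrow>
     universe M \<noteq> {} \<and>
     (\<forall>f\<in>fun_syms M. \<forall>xs\<in>tuples M (fun_arity M f). fun_interp M f xs \<in> universe M)"

section \<open>Formulas and satisfaction\<close>

datatype 'f fo_term = Var nat | App 'f "'f fo_term list"

datatype ('f, 'r) fo_formula =
    Eq "'f fo_term" "'f fo_term"
  | Rel 'r "'f fo_term list"
  | Neg "('f, 'r) fo_formula"
  | Conj "('f, 'r) fo_formula" "('f, 'r) fo_formula"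
  | Ex nat "('f, 'r) fo_formula"

fun wf_term :: "('f, 'r, 'a) fo_structure \<Rightarrow> 'f fo_term \<Rightarrow> bool" where
  "wf_term M (Var x) \<longleftrightarrow> True"
| "wf_term M (App f ts) \<longleftrightarrow>
     f \<in> fun_syms M \<and> length ts = fun_arity M f \<and> (\<forall>t\<in>set ts. wf_term M t)"

fun wf_formula :: "('f, 'r, 'a) fo_structure \<Rightarrow> ('f, 'r) fo_formula \<Rightarrow> bool" where
  "wf_formula M (Eq s t) \<longleftrightarrow> wf_term M s \<and> wf_term M t"
| "wf_formula M (Rel r ts) \<longleftrightarrow>
     r \<in> rel_syms M \<and> length ts = rel_arity M r \<and> (\<forall>t\<in>set ts. wf_term M t)"
| "wf_formula M (Neg \<phi>) \<longleftrightarrow> wf_formula M \<phi>"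
| "wf_formula M (Conj \<phi> \<psi>) \<longleftrightarrow> wf_formula M \<phi> \<and> wf_formula M \<psi>"
| "wf_formula M (Ex x \<phi>) \<longleftrightarrow> wf_formula M \<phi>"

fun vars_term :: "'f fo_term \<Rightarrow> nat set" where
  "vars_term (Var x) = {x}"
| "vars_term (App f ts) = (\<Union>t\<in>set ts. vars_term t)"

fun free_vars :: "('f, 'r) fo_formula \<Rightarrow> nat set" where
  "free_vars (Eq s t) = vars_term s \<union> vars_term t"
| "free_vars (Rel r ts) = (\<Union>t\<in>set ts. vars_term t)"
| "free_vars (Neg \<phi>) = free_vars \<phi>"
| "free_vars (Conj \<phi> \<psi>) = free_vars \<phi> \<union> free_vars \<psi>"
| "free_vars (Ex x \<phi>) = free_vars \<phi> - {x}"

fun eval_term :: "('f, 'r, 'a) fo_structure \<Rightarrow> (nat \<Rightarrow> 'a) \<Rightarrow> 'f fo_term \<Rightarrow> 'a" where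
  "eval_term M s (Var x) = s x"
| "eval_term M s (App f ts) = fun_interp M f (map (eval_term M s) ts)"

fun sat :: "('f, 'r, 'a) fo_structure \<Rightarrow> (nat \<Rightarrow> 'a) \<Rightarrow> ('f, 'r) fo_formula \<Rightarrow> bool" where
  "sat M s (Eq t u) \<longleftrightarrow> eval_term M s t = eval_term M s u"
| "sat M s (Rel r ts) \<longleftrightarrow> map (eval_term M s) ts \<in> rel_interp M r"
| "sat M s (Neg \<phi>) \<longleftrightarrow> \<not> sat M s \<phi>"
| "sat M s (Conj \<phi> \<psi>) \<longleftrightarrow> sat M s \<phi> \<and> sat M s \<psi>"
| "sat M s (Ex x \<phi>) \<longleftrightarrow> (\<exists>a\<in>universe M. sat M (s(x := a)) \<phi>)"

section \<open>Definable closure, automorphisms, rigidity\<close>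

text \<open>
  The parameters are the values under \<open>s\<close> of the free variables of \<open>\<phi>\<close> other than \<open>x\<close>;
  the remaining values of \<open>s\<close> do not influence satisfaction.
\<close>

definition definable_over :: "('f, 'r, 'a) fo_structure \<Rightarrow> 'a set \<Rightarrow> 'a set \<Rightarrow> bool" where
  "definable_over M A X \<longleftrightarrow>
     (\<exists>\<phi> x s. wf_formula M \<phi> \<and> s ` (free_vars \<phi> - {x}) \<subseteq> A \<and>
              X = {c \<in> universe M. sat M (s(x := c)) \<phi>})"

definition dcl :: "('f, 'r, 'a) fo_structure \<Rightarrow> 'a set \<Rightarrow> 'a set" where
  "dcl M A = {b \<in> universe M. definable_over M A {b}}"

definition automorphism :: "('f, 'r, 'a) fo_structure \<Rightarrow> ('a \<Rightarrow> 'a) \<Rightarrow> bool" where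
  "automorphism M h \<longleftrightarrow>
     bij_betw h (universe M) (universe M) \<and>
     (\<forall>f\<in>fun_syms M. \<forall>xs\<in>tuples M (fun_arity M f).
        h (fun_interp M f xs) = fun_interp M f (map h xs)) \<and>
     (\<forall>r\<in>rel_syms M. \<forall>xs\<in>tuples M (rel_arity M r).
        xs \<in> rel_interp M r \<longleftrightarrow> map h xs \<in> rel_interp M r)"

definition sem_rigid :: "('f, 'r, 'a) fo_structure \<Rightarrow> 'a set \<Rightarrow> bool" where
  "sem_rigid M A \<longleftrightarrow>
     (\<forall>h. automorphism M h \<and> (\<forall>a\<in>A. h a = a) \<longrightarrow> (\<forall>x\<in>universe M. h x = x))"

definition synt_rigid :: "('f, 'r, 'a) fo_structure \<Rightarrow> 'a set \<Rightarrow> bool" where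
  "synt_rigid M A \<longleftrightarrow> universe M = dcl M A"

text \<open>Finiteness is explicit because \<^const>\<open>card\<close> is 0 on infinite sets.\<close>

definition ex_sem_rigid :: "('f, 'r, 'a) fo_structure \<Rightarrow> nat \<Rightarrow> bool" where
  "ex_sem_rigid M n \<longleftrightarrow> (\<exists>A\<subseteq>universe M. finite A \<and> card A = n \<and> sem_rigid M A)"

definition ex_synt_rigid :: "('f, 'r, 'a) fo_structure \<Rightarrow> nat \<Rightarrow> bool" where
  "ex_synt_rigid M n \<longleftrightarrow> (\<exists>A\<subseteq>universe M. finite A \<and> card A = n \<and> synt_rigid M A)"

definition deg_ex_sem :: "('f, 'r, 'a) fo_structure \<Rightarrow> enat" where
  "deg_ex_sem M =
     (if \<exists>n. ex_sem_rigid M n then enat (LEAST n. ex_sem_rigid M n) else \<infinity>)"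

definition deg_ex_synt :: "('f, 'r, 'a) fo_structure \<Rightarrow> enat" where
  "deg_ex_synt M =
     (if \<exists>n. ex_synt_rigid M n then enat (LEAST n. ex_synt_rigid M n) else \<infinity>)"

definition DEG :: "(enat \<times> enat) set" where
  "DEG = {(\<mu>, \<nu>). \<mu> \<le> \<nu>}"

end

theory Submission
  imports Defs "HOL-Library.Nat_Bijection" "HOL-Combinatorics.Transposition"
begin

text \<open>
  The first part is the invariance of formulas under automorphisms: an automorphism fixing \<open>A\<close>
  pointwise fixes every element of \<open>dcl A\<close> (\<open>automorphism_fixes_dcl\<close>), so every set witnessing
  syntactic rigidity also witnesses semantic rigidity, and the semantic degree cannot be larger.

  For the second part, a countable structure with unary predicates only realizes each pair
  \<open>(m, m + k)\<close>, where \<open>m\<close> and \<open>k\<close> may be infinite.  It contains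

    \<^item> \<open>m\<close> pairs of \<^emph>\<open>twins\<close>: a predicate holds of exactly the two twins, and nothing tells them
      apart.  One of the two has to be a parameter, both for semantic and for syntactic rigidity.
    \<^item> \<open>k\<close> \<^emph>\<open>limit points\<close>: each lies in an infinite row, singled out by a predicate, all of whose
      other points are \<^emph>\<open>isolated\<close>, that is, named by a predicate of their own.  Taken together, the
      predicates distinguish the limit point from all other points.  But a formula mentions only
      finitely many of them, and it cannot distinguish the limit point from the isolated points of
      its row that are neither named by these predicates nor parameters.  So a limit point costs
      nothing semantically, whereas syntactically it has to be a parameter itself.

  That a limit point is undefinable needs no model theory beyond automorphisms: a definition in the
  full structure is a definition in a reduct to finitely many relation symbols
  (\<open>dcl_finite_reduct\<close>), and the reduct has an automorphism that exchanges the limit point with an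
  isolated one.
\<close>

section \<open>Automorphisms and definable closure\<close>

lemma eval_term_automorphism:
  assumes M: "is_structure M" and h: "automorphism M h"
  shows "wf_term M t \<Longrightarrow> \<forall>v\<in>vars_term t. s v \<in> universe M \<and> s' v = h (s v) \<Longrightarrow>
    eval_term M s t \<in> universe M \<and> eval_term M s' t = h (eval_term M s t)"
proof (induction t)
  case (Var x)
  then show ?case by simp
next
  case (App f ts)
  have IH: "eval_term M s t \<in> universe M \<and> eval_term M s' t = h (eval_term M s t)"
    if "t \<in> set ts" for t
    using App that by auto
  have tup: "map (eval_term M s) ts \<in> tuples M (fun_arity M f)"
    using App.prems IH by (auto simp: tuples_def)
  have "map (eval_term M s') ts = map h (map (eval_term M s) ts)"
    using IH by simp
  then show ?case
    using App.prems tup M h unfolding is_structure_def automorphism_def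
    by (metis eval_term.simps(2) wf_term.simps(2))
qed

text \<open>
  The hypothesis on the assignments concerns the free variables only, because the assignment in the
  definition of definability is unconstrained elsewhere and may even leave the universe.
\<close>

lemma sat_automorphism:
  assumes M: "is_structure M" and h: "automorphism M h"
  shows "wf_formula M \<phi> \<Longrightarrow> \<forall>v\<in>free_vars \<phi>. s v \<in> universe M \<and> s' v = h (s v) \<Longrightarrow>
    sat M s' \<phi> \<longleftrightarrow> sat M s \<phi>"
proof (induction \<phi> arbitrary: s s')
  case (Eq t u)
  have "inj_on h (universe M)"
    using h by (auto simp: automorphism_def bij_betw_def)
  then show ?case
    using Eq eval_term_automorphism[OF M h, of t s s'] eval_term_automorphism[OF M h, of u s s']
    by (auto dest: inj_onD)
next
  case (Rel r ts)
  have ev: "eval_term M s t \<in> universe M \<and> eval_term M s' t = h (eval_term M s t)"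
    if "t \<in> set ts" for t
    using Rel that by (intro eval_term_automorphism[OF M h]) auto
  have tup: "map (eval_term M s) ts \<in> tuples M (rel_arity M r)"
    using Rel.prems ev by (auto simp: tuples_def)
  have "map (eval_term M s') ts = map h (map (eval_term M s) ts)"
    using ev by simp
  then show ?case
    using Rel.prems tup h unfolding automorphism_def by (metis sat.simps(2) wf_formula.simps(2))
next
  case (Neg \<phi>)
  then show ?case by simp
next
  case (Conj \<phi> \<psi>)
  then show ?case by (metis UnI1 UnI2 free_vars.simps(4) sat.simps(4) wf_formula.simps(4))
next
  case (Ex x \<phi>)
  have im: "universe M = h ` universe M"
    using h by (auto simp: automorphism_def bij_betw_def)
  have "sat M (s'(x := h a)) \<phi> \<longleftrightarrow> sat M (s(x := a)) \<phi>" if "a \<in> universe M" for a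
    using Ex.prems that by (intro Ex.IH) auto
  moreover have "sat M s' (Ex x \<phi>) \<longleftrightarrow> (\<exists>a\<in>universe M. sat M (s'(x := h a)) \<phi>)"
    by (subst sat.simps, subst im) simp
  ultimately show ?case by simp
qed

lemma automorphism_fixes_dcl:
  assumes M: "is_structure M" and h: "automorphism M h" and A: "A \<subseteq> universe M"
    and fixA: "\<forall>a\<in>A. h a = a" and b: "b \<in> dcl M A"
  shows "h b = b"
proof -
  obtain \<phi> x s where wf: "wf_formula M \<phi>" and s: "s ` (free_vars \<phi> - {x}) \<subseteq> A"
    and X: "{b} = {c \<in> universe M. sat M (s(x := c)) \<phi>}"
    using b by (auto simp: dcl_def definable_over_def)
  have b': "b \<in> universe M" "sat M (s(x := b)) \<phi>"
    using X by blast+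
  have hb: "h b \<in> universe M"
    using h b' by (auto simp: automorphism_def bij_betw_def)
  have "sat M (s(x := h b)) \<phi> \<longleftrightarrow> sat M (s(x := b)) \<phi>"
    using s A fixA b' by (intro sat_automorphism[OF M h wf]) auto
  then show ?thesis
    using X b' hb by blast
qed

lemma synt_rigid_imp_sem_rigid:
  assumes "is_structure M" "A \<subseteq> universe M" "synt_rigid M A"
  shows "sem_rigid M A"
  using automorphism_fixes_dcl[OF assms(1) _ assms(2)] assms(3)
  by (auto simp: sem_rigid_def synt_rigid_def)

lemma deg_ex_sem_le_deg_ex_synt:
  assumes "is_structure M"
  shows "deg_ex_sem M \<le> deg_ex_synt M"
proof (cases "\<exists>n. ex_synt_rigid M n")
  case True
  let ?n = "LEAST n. ex_synt_rigid M n"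
  have "ex_synt_rigid M ?n"
    using True by (rule LeastI_ex)
  then have "ex_sem_rigid M ?n"
    using synt_rigid_imp_sem_rigid[OF assms] by (auto simp: ex_synt_rigid_def ex_sem_rigid_def)
  then show ?thesis
    using True by (auto simp: deg_ex_sem_def deg_ex_synt_def intro: Least_le)
qed (simp add: deg_ex_synt_def)

section \<open>Finite reducts\<close>

text \<open>
  Forgetting relation symbols does not change satisfaction, because the set of relation symbols only
  restricts which formulas are well-formed.  As a formula contains finitely many symbols, every
  definition already lives in a finite reduct.
\<close>

lemma wf_term_reduct [simp]: "wf_term (M\<lparr>rel_syms := F\<rparr>) t \<longleftrightarrow> wf_term M t"
  by (induction t) auto

lemma eval_term_reduct [simp]: "eval_term (M\<lparr>rel_syms := F\<rparr>) s t = eval_term M s t"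
  by (induction t) (auto cong: map_cong)

lemma sat_reduct [simp]: "sat (M\<lparr>rel_syms := F\<rparr>) s \<phi> \<longleftrightarrow> sat M s \<phi>"
proof (induction \<phi> arbitrary: s)
  case (Rel r ts)
  have "eval_term (M\<lparr>rel_syms := F\<rparr>) s = eval_term M s"
    by (rule ext) simp
  then show ?case by simp
qed simp_all

lemma wf_formula_reduct_mono:
  "wf_formula (M\<lparr>rel_syms := F\<rparr>) \<phi> \<Longrightarrow> F \<subseteq> G \<Longrightarrow> wf_formula (M\<lparr>rel_syms := G\<rparr>) \<phi>"
  by (induction \<phi>) auto

lemma wf_formula_finite_reduct:
  "wf_formula M \<phi> \<Longrightarrow>
    \<exists>F. finite F \<and> F \<subseteq> rel_syms M \<and> wf_formula (M\<lparr>rel_syms := F\<rparr>) \<phi>"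
proof (induction \<phi>)
  case (Eq t u)
  then show ?case by (intro exI[of _ "{}"]) auto
next
  case (Rel r ts)
  then show ?case by (intro exI[of _ "{r}"]) auto
next
  case (Conj \<phi> \<psi>)
  then obtain F G where "finite F" "F \<subseteq> rel_syms M" "wf_formula (M\<lparr>rel_syms := F\<rparr>) \<phi>"
    and "finite G" "G \<subseteq> rel_syms M" "wf_formula (M\<lparr>rel_syms := G\<rparr>) \<psi>"
    by auto
  then show ?case
    by (intro exI[of _ "F \<union> G"]) (auto intro: wf_formula_reduct_mono)
qed auto

lemma dcl_finite_reduct:
  assumes "b \<in> dcl M A"
  obtains F where "finite F" "F \<subseteq> rel_syms M" "b \<in> dcl (M\<lparr>rel_syms := F\<rparr>) A"
proof -
  obtain \<phi> x s where wf: "wf_formula M \<phi>" and s: "s ` (free_vars \<phi> - {x}) \<subseteq> A"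
    and X: "{b} = {c \<in> universe M. sat M (s(x := c)) \<phi>}" and b: "b \<in> universe M"
    using assms by (auto simp: dcl_def definable_over_def)
  obtain F where F: "finite F" "F \<subseteq> rel_syms M" "wf_formula (M\<lparr>rel_syms := F\<rparr>) \<phi>"
    using wf_formula_finite_reduct[OF wf] by blast
  have "definable_over (M\<lparr>rel_syms := F\<rparr>) A {b}"
    unfolding definable_over_def using F(3) s X
    by (intro exI[of _ \<phi>] exI[of _ x] exI[of _ s]) simp
  then show ?thesis
    using that F b by (simp add: dcl_def)
qed

section \<open>Structures with unary predicates\<close>

definition unary_structure :: "'a set \<Rightarrow> 'r set \<Rightarrow> ('r \<Rightarrow> 'a set) \<Rightarrow> ('f, 'r, 'a) fo_structure" where
  "unary_structure U R P =
     \<lparr>fun_syms = {}, fun_arity = (\<lambda>_. 0), rel_syms = R, rel_arity = (\<lambda>_. 1),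
      universe = U, fun_interp = (\<lambda>_ _. undefined), rel_interp = (\<lambda>r. (\<lambda>y. [y]) ` P r)\<rparr>"

lemma unary_structure_simps [simp]:
  "universe (unary_structure U R P) = U"
  "rel_syms (unary_structure U R P) = R"
  "(unary_structure U R P)\<lparr>rel_syms := F\<rparr> = unary_structure U F P"
  "is_structure (unary_structure U R P) \<longleftrightarrow> U \<noteq> {}"
  by (auto simp: unary_structure_def is_structure_def)

lemma automorphism_unary_structure:
  "automorphism (unary_structure U R P :: ('f, 'r, 'a) fo_structure) h \<longleftrightarrow>
     bij_betw h U U \<and> (\<forall>r\<in>R. \<forall>y\<in>U. y \<in> P r \<longleftrightarrow> h y \<in> P r)"
proof -
  let ?M = "unary_structure U R P :: ('f, 'r, 'a) fo_structure"
  have tup: "tuples ?M (rel_arity ?M r) = (\<lambda>y. [y]) ` U" for r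
    by (auto simp: unary_structure_def tuples_def length_Suc_conv)
  have "[y] \<in> rel_interp ?M r \<longleftrightarrow> y \<in> P r" for y r
    by (auto simp: unary_structure_def)
  moreover have "fun_syms ?M = {}"
    by (simp add: unary_structure_def)
  ultimately show ?thesis
    by (simp add: automorphism_def tup)
qed

lemma automorphism_transpose:
  assumes "x \<in> U" "y \<in> U" "\<forall>r\<in>R. x \<in> P r \<longleftrightarrow> y \<in> P r"
  shows "automorphism (unary_structure U R P) (transpose x y)"
  using assms by (auto simp: automorphism_unary_structure transpose_def)

text \<open>
  Exchanging two points that satisfy the same predicates is an automorphism, and conversely every
  automorphism moves a point to one that satisfies the same predicates.
\<close>

lemma sem_rigid_unary_structure:
  assumes "A \<subseteq> U"
  shows "sem_rigid (unary_structure U R P :: ('f, 'r, 'a) fo_structure) A \<longleftrightarrow>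
    (\<forall>x\<in>U - A. \<forall>y\<in>U - A. (\<forall>r\<in>R. x \<in> P r \<longleftrightarrow> y \<in> P r) \<longrightarrow> x = y)"
proof (intro iffI ballI impI)
  fix x y
  assume rig: "sem_rigid (unary_structure U R P :: ('f, 'r, 'a) fo_structure) A" and xy: "x \<in> U - A" "y \<in> U - A"
    and "\<forall>r\<in>R. x \<in> P r \<longleftrightarrow> y \<in> P r"
  then have "automorphism (unary_structure U R P :: ('f, 'r, 'a) fo_structure) (transpose x y)"
    by (intro automorphism_transpose) auto
  moreover have "\<forall>a\<in>A. transpose x y a = a"
    using xy by (auto simp: transpose_def)
  ultimately have "transpose x y x = x"
    using rig xy unfolding sem_rigid_def unary_structure_simps by blast
  then show "x = y"
    by simp
next
  assume sep: "\<forall>x\<in>U - A. \<forall>y\<in>U - A. (\<forall>r\<in>R. x \<in> P r \<longleftrightarrow> y \<in> P r) \<longrightarrow> x = y"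
  show "sem_rigid (unary_structure U R P :: ('f, 'r, 'a) fo_structure) A"
    unfolding sem_rigid_def
  proof (intro allI impI ballI)
    fix h x
    assume h: "automorphism (unary_structure U R P :: ('f, 'r, 'a) fo_structure) h \<and> (\<forall>a\<in>A. h a = a)"
      and "x \<in> universe (unary_structure U R P :: ('f, 'r, 'a) fo_structure)"
    then have x: "x \<in> U" and inj: "inj_on h U" and hx: "h x \<in> U"
      and pres: "\<forall>r\<in>R. x \<in> P r \<longleftrightarrow> h x \<in> P r"
      by (auto simp: automorphism_unary_structure bij_betw_def)
    show "h x = x"
    proof (cases "x \<in> A \<or> h x \<in> A")
      case True
      then show ?thesis
        using h inj x hx by (auto dest: inj_onD)
    next
      case False
      then show ?thesis
        using sep x hx pres by auto
    qed
  qed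
qed

lemma dcl_unary_structure_param:
  assumes "b \<in> A" "b \<in> U"
  shows "b \<in> dcl (unary_structure U R P) A"
proof -
  have "definable_over (unary_structure U R P) A {b}"
    unfolding definable_over_def using assms
    by (intro exI[of _ "Eq (Var 0) (Var 1)"] exI[of _ 0] exI[of _ "\<lambda>_. b"]) auto
  then show ?thesis
    using assms by (simp add: dcl_def)
qed

lemma dcl_unary_structure_singleton:
  assumes "r \<in> R" "b \<in> U" "P r = {b}"
  shows "b \<in> dcl (unary_structure U R P) A"
proof -
  have "definable_over (unary_structure U R P) A {b}"
    unfolding definable_over_def using assms
    by (intro exI[of _ "Rel r [Var 0]"] exI[of _ 0]) (auto simp: unary_structure_def)
  then show ?thesis
    using assms by (simp add: dcl_def)
qed

lemma dcl_unary_structure_doubleton: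
  assumes "r \<in> R" "b \<in> U" "P r = {a, b}" "a \<in> A" "a \<noteq> b"
  shows "b \<in> dcl (unary_structure U R P) A"
proof -
  have "definable_over (unary_structure U R P) A {b}"
    unfolding definable_over_def using assms
    by (intro exI[of _ "Conj (Rel r [Var 0]) (Neg (Eq (Var 0) (Var 1)))"] exI[of _ 0]
        exI[of _ "\<lambda>_. a"]) (auto simp: unary_structure_def)
  then show ?thesis
    using assms by (simp add: dcl_def)
qed

text \<open>
  An element escapes the definable closure as soon as no finite set of predicates separates it from
  all other non-parameters, even if the predicates together do.  This is where the two degrees
  can diverge.
\<close>

lemma not_dcl_unary_structure:
  assumes A: "A \<subseteq> U" and b: "b \<in> U - A"
    and nonsep: "\<And>F. finite F \<Longrightarrow> F \<subseteq> R \<Longrightarrow>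
      \<exists>y\<in>U - A. y \<noteq> b \<and> (\<forall>r\<in>F. b \<in> P r \<longleftrightarrow> y \<in> P r)"
  shows "b \<notin> dcl (unary_structure U R P :: ('f, 'r, 'a) fo_structure) A"
proof
  assume "b \<in> dcl (unary_structure U R P :: ('f, 'r, 'a) fo_structure) A"
  then obtain F where F: "finite F" "F \<subseteq> R"
    and dcl: "b \<in> dcl (unary_structure U F P :: ('f, 'r, 'a) fo_structure) A"
    by (rule dcl_finite_reduct) simp
  obtain y where y: "y \<in> U - A" "y \<noteq> b" "\<forall>r\<in>F. b \<in> P r \<longleftrightarrow> y \<in> P r"
    using nonsep[OF F] by blast
  have "transpose b y b = b"
  proof (rule automorphism_fixes_dcl[where h = "transpose b y", OF _ _ _ _ dcl])
    show "automorphism (unary_structure U F P :: ('f, 'r, 'a) fo_structure) (transpose b y)"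
      using b y by (intro automorphism_transpose) auto
    show "\<forall>a\<in>A. transpose b y a = a"
      using b y by (auto simp: transpose_def)
  qed (use A b in auto)
  with y show False
    by simp
qed

section \<open>Counting with extended natural numbers\<close>

definition ecard :: "'a set \<Rightarrow> enat" where
  "ecard A = (if finite A then enat (card A) else \<infinity>)"

lemma ecard_Un_disjoint: "A \<inter> B = {} \<Longrightarrow> ecard (A \<union> B) = ecard A + ecard B"
  by (auto simp: ecard_def card_Un_disjoint)

lemma ecard_image: "inj_on f A \<Longrightarrow> ecard (f ` A) = ecard A"
  by (auto simp: ecard_def card_image finite_image_iff)

lemma ecard_initial_segment: "ecard {i. enat i < m} = m"
  by (cases m) (auto simp: ecard_def lessThan_def[symmetric])

text \<open>
  Both degrees of the structures below have this form: \<open>T\<close> represents the classes that the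
  parameters have to meet, and \<open>g\<close> maps a point to its class.
\<close>

lemma least_card_meeting_classes:
  fixes T U :: "'a set" and g :: "'a \<Rightarrow> 'b"
  assumes T: "T \<subseteq> U" and inj: "inj_on g T"
  defines "Q \<equiv> \<lambda>n. \<exists>A\<subseteq>U. finite A \<and> card A = n \<and> g ` T \<subseteq> g ` A"
  shows "(if \<exists>n. Q n then enat (LEAST n. Q n) else \<infinity>) = ecard T"
proof -
  have lower: "finite T \<and> card T \<le> n" if "Q n" for n
  proof -
    obtain A where A: "finite A" "card A = n" "g ` T \<subseteq> g ` A"
      using \<open>Q n\<close> by (auto simp: Q_def)
    have "finite T"
      using A inj by (meson finite_imageD finite_imageI finite_subset)
    moreover have "card T = card (g ` T)"
      using inj by (simp add: card_image)
    moreover have "card (g ` T) \<le> card (g ` A)"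
      using A by (intro card_mono) auto
    moreover have "card (g ` A) \<le> card A"
      using A by (intro card_image_le) auto
    ultimately show ?thesis
      using A by simp
  qed
  show ?thesis
  proof (cases "finite T")
    case True
    then have Q: "Q (card T)"
      using T by (auto simp: Q_def)
    then have "(LEAST n. Q n) = card T"
      using lower by (intro Least_equality) auto
    then show ?thesis
      using True Q by (auto simp: ecard_def)
  next
    case False
    then show ?thesis
      using lower by (auto simp: ecard_def)
  qed
qed

section \<open>Twins and limit points\<close>

text \<open>
  The natural number coding \<open>(i, j)\<close> is thought of as the point in row \<open>i\<close> and column \<open>j\<close>.  Columns
  0 and 1 hold the twins, column 2 holds the limit points, and the columns from 3 on hold the
  isolated points.  There are \<open>m\<close> pairs of twins and \<open>k\<close> limit points; the isolated points are
  always there, so the structure is nonempty even if \<open>m\<close> and \<open>k\<close> are both 0.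
\<close>

definition points :: "enat \<Rightarrow> enat \<Rightarrow> nat set" where
  "points m k =
     {x. case prod_decode x of (i, j) \<Rightarrow> (j < 2 \<longrightarrow> enat i < m) \<and> (j = 2 \<longrightarrow> enat i < k)}"

text \<open>
  Every point also serves as a relation symbol, whose predicate is the neighbourhood of the point:
  the pair for a twin, the row from column 2 on for a limit point, and the singleton for an isolated
  point.
\<close>

definition nbhd :: "nat \<Rightarrow> nat set" where
  "nbhd x = {y. case (prod_decode x, prod_decode y) of ((i, j), (i', j')) \<Rightarrow>
     i' = i \<and> (if j < 2 then j' < 2 else if j = 2 then j' \<ge> 2 else j' = j)}"

abbreviation twin_limit_structure :: "enat \<Rightarrow> enat \<Rightarrow> ('f, nat, nat) fo_structure" where
  "twin_limit_structure m k \<equiv> unary_structure (points m k) (points m k) nbhd"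

lemma prod_encode_cases:
  obtains i j where "x = prod_encode (i, j)"
  by (metis prod_decode_inverse surj_pair)

lemma mem_points [simp]:
  "prod_encode (i, j) \<in> points m k \<longleftrightarrow> (j < 2 \<longrightarrow> enat i < m) \<and> (j = 2 \<longrightarrow> enat i < k)"
  by (simp add: points_def)

lemma points_nonempty: "points m k \<noteq> {}"
proof -
  have "prod_encode (0, 3) \<in> points m k"
    by simp
  then show ?thesis
    by blast
qed

lemma mem_nbhd [simp]:
  "prod_encode (i', j') \<in> nbhd (prod_encode (i, j)) \<longleftrightarrow>
     i' = i \<and> (if j < 2 then j' < 2 else if j = 2 then j' \<ge> 2 else j' = j)"
  by (simp add: nbhd_def)

lemma nbhd_eq_iff:
  "nbhd (prod_encode (i, j)) = nbhd (prod_encode (i', j')) \<longleftrightarrow>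
     i = i' \<and> (j < 2 \<and> j' < 2 \<or> j = j')" (is "?L \<longleftrightarrow> ?R")
proof
  assume eq: ?L
  have 1: "prod_encode (i, j) \<in> nbhd (prod_encode (i', j'))"
    unfolding eq[symmetric] by simp
  then have i: "i = i'"
    by simp
  have "prod_encode (i', j') \<in> nbhd (prod_encode (i, j))"
    unfolding eq by simp
  with 1 i show ?R
    unfolding mem_nbhd by (smt (verit))
next
  assume R: ?R
  have "y \<in> nbhd (prod_encode (i, j)) \<longleftrightarrow> y \<in> nbhd (prod_encode (i', j'))" for y
    by (cases y rule: prod_encode_cases) (use R in \<open>elim conjE disjE; simp\<close>)
  then show ?L
    by blast
qed

text \<open>
  Two distinct points are separated by the neighbourhood of one of them unless they are twins: an
  isolated point is alone in its neighbourhood, and different limit points lie in different rows.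
  Hence only unmarked pairs of twins leave room for an automorphism.  Twins have the same
  neighbourhood, and no other point has it, so an inclusion between images under \<open>nbhd\<close> says that
  each pair is met.
\<close>

lemma sem_rigid_twin_limit:
  assumes A: "A \<subseteq> points m k"
  shows "sem_rigid (twin_limit_structure m k) A \<longleftrightarrow>
    nbhd ` (\<lambda>i. prod_encode (i, 0)) ` {i. enat i < m} \<subseteq> nbhd ` A"
    (is "?L \<longleftrightarrow> ?R")
proof
  assume ?L
  show ?R
  proof clarify
    fix i assume i: "enat i < m"
    show "nbhd (prod_encode (i, 0)) \<in> nbhd ` A"
    proof (rule ccontr)
      assume "nbhd (prod_encode (i, 0)) \<notin> nbhd ` A"
      moreover have "nbhd (prod_encode (i, 1)) = nbhd (prod_encode (i, 0))"
        by (simp add: nbhd_eq_iff)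
      ultimately have "prod_encode (i, 0) \<notin> A" "prod_encode (i, 1) \<notin> A"
        by (metis imageI)+
      then have "prod_encode (i, 0) \<in> points m k - A" "prod_encode (i, 1) \<in> points m k - A"
        using i by simp_all
      moreover have "prod_encode (i, 0) \<in> nbhd z \<longleftrightarrow> prod_encode (i, 1) \<in> nbhd z" for z
        by (cases z rule: prod_encode_cases) simp
      ultimately have "prod_encode (i, 0) = prod_encode (i, 1)"
        using \<open>?L\<close>[unfolded sem_rigid_unary_structure[OF A]] by blast
      then show False
        by simp
    qed
  qed
next
  assume R: ?R
  have "x = y" if x: "x \<in> points m k - A" and y: "y \<in> points m k - A"
    and same: "\<forall>z\<in>points m k. x \<in> nbhd z \<longleftrightarrow> y \<in> nbhd z" for x y
  proof -
    obtain i j i' j' where xy: "x = prod_encode (i, j)" "y = prod_encode (i', j')"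
      by (metis prod_encode_cases)
    have near: "y \<in> nbhd x" "x \<in> nbhd y"
      using same x y by (auto simp: xy simp del: mem_points)
    then have i: "i = i'"
      by (simp add: xy)
    consider "x = y" | "j < 2" "j' < 2" "j \<noteq> j'"
      using near i unfolding xy mem_nbhd by (smt (verit))
    then show ?thesis
    proof cases
      case 2
      then have "nbhd (prod_encode (i, 0)) \<in> nbhd ` A"
        using R x by (auto simp: xy)
      then obtain a where a: "a \<in> A" "nbhd a = nbhd (prod_encode (i, 0))"
        by auto
      obtain l n where ln: "a = prod_encode (l, n)"
      by (rule prod_encode_cases)
      have "l = i" "n < 2"
        using a(2) by (auto simp: ln nbhd_eq_iff)
      \<comment> \<open>Two distinct columns below 2 exhaust the twins of the row.\<close>
      then have "a = x \<or> a = y"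
        using 2 by (auto simp: xy i ln)
      then show ?thesis
        using a x y by auto
    qed
  qed
  then show ?L
    using sem_rigid_unary_structure[OF A] by blast
qed

text \<open>
  A limit point shares its neighbourhood with no other point, so for limit points the inclusion says
  that they all belong to \<open>A\<close>.  They have to: given finitely many symbols and parameters, some
  isolated point of the row involves none of them and can be exchanged with the limit point.
\<close>

lemma synt_rigid_twin_limit:
  assumes A: "A \<subseteq> points m k" and fin: "finite A"
  shows "synt_rigid (twin_limit_structure m k :: ('f, nat, nat) fo_structure) A \<longleftrightarrow>
    nbhd ` ((\<lambda>i. prod_encode (i, 0)) ` {i. enat i < m} \<union>
            (\<lambda>i. prod_encode (i, 2)) ` {i. enat i < k}) \<subseteq> nbhd ` A"
    (is "synt_rigid ?M A \<longleftrightarrow> nbhd ` (?T \<union> ?L) \<subseteq> nbhd ` A")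
proof
  assume rig: "synt_rigid ?M A"
  have "is_structure ?M"
    by (simp add: points_nonempty)
  then have "sem_rigid ?M A"
    using A rig by (intro synt_rigid_imp_sem_rigid) auto
  then have "nbhd ` ?T \<subseteq> nbhd ` A"
    by (simp add: sem_rigid_twin_limit[OF A])
  moreover have "?L \<subseteq> A"
  proof clarify
    fix i assume i: "enat i < k"
    show "prod_encode (i, 2) \<in> A"
    proof (rule ccontr)
      assume no: "prod_encode (i, 2) \<notin> A"
      have "prod_encode (i, 2) \<notin> dcl ?M A"
      proof (rule not_dcl_unary_structure[OF A])
        show "prod_encode (i, 2) \<in> points m k - A"
          using i no by simp
        fix F :: "nat set" assume "finite F"
        have "infinite ((\<lambda>j. prod_encode (i, j)) ` {3..})"
          by (subst finite_image_iff) (auto simp: inj_on_def infinite_Ici)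
        then have "\<not> (\<lambda>j. prod_encode (i, j)) ` {3..} \<subseteq> A \<union> F"
          using fin \<open>finite F\<close> by (meson finite_UnI finite_subset)
        then obtain j where j: "j \<ge> 3" "prod_encode (i, j) \<notin> A" "prod_encode (i, j) \<notin> F"
          by auto
        have "prod_encode (i, 2) \<in> nbhd z \<longleftrightarrow> prod_encode (i, j) \<in> nbhd z" if "z \<in> F" for z
        proof -
          obtain l n where z: "z = prod_encode (l, n)"
      by (rule prod_encode_cases)
          \<comment> \<open>The only set in the family that contains the isolated point but not the limit point is
            the singleton of the isolated point, and its symbol is not in \<open>F\<close>.\<close>
          then show ?thesis
            using j that by auto
        qed
        then show "\<exists>y\<in>points m k - A. y \<noteq> prod_encode (i, 2) \<and>
            (\<forall>z\<in>F. prod_encode (i, 2) \<in> nbhd z \<longleftrightarrow> y \<in> nbhd z)"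
          using j by (intro bexI[of _ "prod_encode (i, j)"]) auto
      qed
      moreover have "prod_encode (i, 2) \<in> dcl ?M A"
        using rig i unfolding synt_rigid_def unary_structure_simps by (metis mem_points less_irrefl)
      ultimately show False
        by simp
    qed
  qed
  ultimately show "nbhd ` (?T \<union> ?L) \<subseteq> nbhd ` A"
    by auto
next
  assume R: "nbhd ` (?T \<union> ?L) \<subseteq> nbhd ` A"
  have "b \<in> dcl ?M A" if b: "b \<in> points m k" for b
  proof -
    obtain i j where ij: "b = prod_encode (i, j)"
      by (rule prod_encode_cases)
    consider "j < 2" | "j = 2" | "j > 2"
      by linarith
    then show ?thesis
    proof cases
      case 1
      then have "nbhd (prod_encode (i, 0)) \<in> nbhd ` A"
        using R b by (auto simp: ij)
      then obtain a where a: "a \<in> A" "nbhd a = nbhd (prod_encode (i, 0))"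
        by auto
      obtain l n where ln: "a = prod_encode (l, n)"
      by (rule prod_encode_cases)
      have n: "l = i" "n < 2"
        using a(2) by (auto simp: ln nbhd_eq_iff)
      show ?thesis
      proof (cases "a = b")
        case True
        then show ?thesis
          using a b by (intro dcl_unary_structure_param) auto
      next
        case False
        then have "y \<in> nbhd b \<longleftrightarrow> y \<in> {a, b}" for y
          using 1 n by (cases y rule: prod_encode_cases) (auto simp: ij ln)
        then have "nbhd b = {a, b}"
          by blast
        then show ?thesis
          using a b False by (intro dcl_unary_structure_doubleton) auto
      qed
    next
      case 2
      then have "nbhd b \<in> nbhd ` A"
        using R b by (auto simp: ij)
      then obtain a where a: "a \<in> A" "nbhd a = nbhd b"
        by auto
      obtain l n where ln: "a = prod_encode (l, n)"
      by (rule prod_encode_cases)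
      have "a = b"
        using a(2) 2 by (auto simp: ln ij nbhd_eq_iff)
      then show ?thesis
        using a b by (intro dcl_unary_structure_param) auto
    next
      case 3
      then have "y \<in> nbhd b \<longleftrightarrow> y = b" for y
        by (cases y rule: prod_encode_cases) (auto simp: ij)
      then have "nbhd b = {b}"
        by blast
      then show ?thesis
        using b by (intro dcl_unary_structure_singleton) auto
    qed
  qed
  then show "synt_rigid ?M A"
    by (auto simp: synt_rigid_def dcl_def)
qed

lemma ecard_column:
  "ecard ((\<lambda>i. prod_encode (i, j)) ` {i. enat i < m}) = m"
  by (subst ecard_image) (auto simp: inj_on_def ecard_initial_segment)

lemma deg_ex_sem_twin_limit:
  "deg_ex_sem (twin_limit_structure m k :: ('f, nat, nat) fo_structure) = m"
proof -
  let ?M = "twin_limit_structure m k :: ('f, nat, nat) fo_structure"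
  let ?T = "(\<lambda>i. prod_encode (i, 0)) ` {i. enat i < m}"
  have T: "?T \<subseteq> points m k" "inj_on nbhd ?T"
    by (auto simp: inj_on_def nbhd_eq_iff)
  have "ex_sem_rigid ?M n \<longleftrightarrow>
      (\<exists>A\<subseteq>points m k. finite A \<and> card A = n \<and> nbhd ` ?T \<subseteq> nbhd ` A)" for n
    by (simp only: ex_sem_rigid_def unary_structure_simps sem_rigid_twin_limit cong: conj_cong)
  then have "deg_ex_sem ?M = ecard ?T"
    by (simp only: deg_ex_sem_def least_card_meeting_classes[OF T])
  then show ?thesis
    by (simp only: ecard_column)
qed

lemma deg_ex_synt_twin_limit:
  "deg_ex_synt (twin_limit_structure m k :: ('f, nat, nat) fo_structure) = m + k"
proof -
  let ?M = "twin_limit_structure m k :: ('f, nat, nat) fo_structure"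
  let ?T = "(\<lambda>i. prod_encode (i, 0)) ` {i. enat i < m}"
  let ?L = "(\<lambda>i. prod_encode (i, 2)) ` {i. enat i < k}"
  have TL: "?T \<union> ?L \<subseteq> points m k" "inj_on nbhd (?T \<union> ?L)"
    by (auto simp: inj_on_def nbhd_eq_iff)
  have "ex_synt_rigid ?M n \<longleftrightarrow>
      (\<exists>A\<subseteq>points m k. finite A \<and> card A = n \<and> nbhd ` (?T \<union> ?L) \<subseteq> nbhd ` A)" for n
    by (simp only: ex_synt_rigid_def unary_structure_simps synt_rigid_twin_limit cong: conj_cong)
  then have "deg_ex_synt ?M = ecard (?T \<union> ?L)"
    by (simp only: deg_ex_synt_def least_card_meeting_classes[OF TL])
  also have "\<dots> = ecard ?T + ecard ?L"
    by (rule ecard_Un_disjoint) auto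
  finally show ?thesis
    by (simp only: ecard_column)
qed

section \<open>The possible pairs of degrees\<close>

theorem theorem2p6:
  shows "(\<forall>M :: ('f, 'r, 'a) fo_structure.
            is_structure M \<longrightarrow> (deg_ex_sem M, deg_ex_synt M) \<in> DEG) \<and>
         (\<forall>\<mu> \<nu>. (\<mu>, \<nu>) \<in> DEG \<longrightarrow>
            (\<exists>M :: (nat, nat, nat) fo_structure.
               is_structure M \<and> deg_ex_sem M = \<mu> \<and> deg_ex_synt M = \<nu>))"
proof (intro conjI allI impI)
  fix M :: "('f, 'r, 'a) fo_structure"
  assume "is_structure M"
  then show "(deg_ex_sem M, deg_ex_synt M) \<in> DEG"
    by (simp add: DEG_def deg_ex_sem_le_deg_ex_synt)
next
  fix \<mu> \<nu> :: enat
  assume "(\<mu>, \<nu>) \<in> DEG"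
  then obtain k where "\<nu> = \<mu> + k"
    by (auto simp: DEG_def le_iff_add)
  moreover have "is_structure (twin_limit_structure \<mu> k :: (nat, nat, nat) fo_structure)"
    by (simp add: points_nonempty)
  ultimately show "\<exists>M :: (nat, nat, nat) fo_structure.
      is_structure M \<and> deg_ex_sem M = \<mu> \<and> deg_ex_synt M = \<nu>"
    by (intro exI[of _ "twin_limit_structure \<mu> k"])
      (auto simp: deg_ex_sem_twin_limit deg_ex_synt_twin_limit)
qed

end
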